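(* Let $1<p<\infty$ and let $w=uv^{1-p}$ be a weight on $\mathbb{R}$ in $A_p$ with $u,v\in A_1$. If $c=\max\{A_1(u),A_1(v)\}$, then $w^\tau\in A_p$ for all $1\le\tau<\frac{c}{c-1}$ (the upper bound being read as $\infty$ if $c=1$). Moreover, this range of $\tau$'s is best possible on $\mathbb{R}_+$: for every $1<p<\infty$ and every $c>1$ there are weights $u,v\in A_1$ on $\mathbb{R}_+$ with $\max\{A_1(u),A_1(v)\}=c$ and $w=uv^{1-p}\in A_p$ (all conditions taken over intervals $I\subset\mathbb{R}_+$) such that $w^\tau\notin A_p$ on $\mathbb{R}_+$ for every $\tau\ge\frac{c}{c-1}$.
   Context: Let $X$ be $\mathbb{R}$ or $\mathbb{R}_+=(0,\infty)$. A weight on $X$ is a positive function integrable on every bounded interval $I\subset X$. Below $I$ denotes an arbitrary bounded interval contained in $X$, $|I|$ is its length, and $\inf_I$ means essential infimum over $I$. For $1<p<\infty$ with $p'=p/(p-1)$, a positive measurable function $w$ on $X$ is in $A_p$ iff $w$ is integrable on every bounded interval $I\subset X$ and there is $C<\infty$ with $\frac{1}{|I|}\int_I w\left(\frac{1}{|I|}\int_I w^{1-p'}\right)^{p-1}\le C$ for all $I$. $w\in A_1$ iff there is $c<\infty$ with $\frac{1}{|I|}\int_I w\le c\inf_I w$ for all $I$; $A_1(w)$ denotes the infimum of all such constants $c$. *)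

theory Defs
  imports "HOL-Probability.Essential_Supremum"
begin

(* Degenerate intervals are excluded, since every condition below divides by the length. *)
definition bounded_intervals :: "real set \<Rightarrow> real set set" where
  "bounded_intervals X =
    {I. is_interval I \<and> bounded I \<and> I \<subseteq> X \<and> 0 < measure lebesgue I}"

definition average :: "real set \<Rightarrow> (real \<Rightarrow> real) \<Rightarrow> real" where
  "average I f = (1 / measure lebesgue I) * set_lebesgue_integral lebesgue I f"

definition essinf_on :: "real set \<Rightarrow> (real \<Rightarrow> real) \<Rightarrow> ereal" where
  "essinf_on I f = - esssup (restrict_space lebesgue I) (\<lambda>x. - ereal (f x))"

(* Functions on X are represented by functions on the whole line, whose values outside X
   are irrelevant. *)
definition weight_on :: "real set \<Rightarrow> (real \<Rightarrow> real) \<Rightarrow> bool" where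
  "weight_on X w \<longleftrightarrow>
    (\<forall>x\<in>X. 0 < w x) \<and> set_borel_measurable lebesgue X w \<and>
    (\<forall>I\<in>bounded_intervals X. set_integrable lebesgue I w)"

(* The Bochner integral of a non-integrable function is 0 by convention. So the finiteness of
   the integral of w^(1-p'), which the bound by C < \<infinity> entails for positive w when integrals
   take values in [0,\<infinity>], has to be demanded explicitly. *)
definition A_p :: "real set \<Rightarrow> real \<Rightarrow> (real \<Rightarrow> real) \<Rightarrow> bool" where
  "A_p X p w \<longleftrightarrow> weight_on X w \<and>
    (let p' = p / (p - 1) in
      \<exists>C::real. \<forall>I\<in>bounded_intervals X.
        set_integrable lebesgue I (\<lambda>x. w x powr (1 - p')) \<and>
        average I w * average I (\<lambda>x. w x powr (1 - p')) powr (p - 1) \<le> C)"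

definition A1_bounds :: "real set \<Rightarrow> (real \<Rightarrow> real) \<Rightarrow> real set" where
  "A1_bounds X w =
    {c. \<forall>I\<in>bounded_intervals X. ereal (average I w) \<le> ereal c * essinf_on I w}"

definition A_1 :: "real set \<Rightarrow> (real \<Rightarrow> real) \<Rightarrow> bool" where
  "A_1 X w \<longleftrightarrow> weight_on X w \<and> A1_bounds X w \<noteq> {}"

definition A1_const :: "real set \<Rightarrow> (real \<Rightarrow> real) \<Rightarrow> real" where
  "A1_const X w = Inf (A1_bounds X w)"

end

theory Submission
  imports Defs
begin

text \<open>The heart of the matter is a sharp self-improvement property: if \<open>u\<close> satisfies the $A_1$ condition on the line with
constant \<open>c\<close>, then $u^\tau$ is an $A_1$ weight for every $1 < \tau < c/(c-1)$ (\<open>A_1_powr\<close>). Applied to both factors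
of $w = u v^{1-p}$ it gives $w^\tau = u^\tau (v^\tau)^{1-p}$ with both $u^\tau$ and $v^\tau$ in $A_1$, and such a
product is always an $A_p$ weight (\<open>A_p_of_A_1\<close>).

Self-improvement rests on a level set estimate without loss in the constant. On an interval \<open>I\<close>, let \<open>E = {u > t}\<close> with
a level \<open>t\<close> above the average of \<open>u\<close>. Then $\int_E u \le c\, t\, |E|$ (\<open>level_set_integral_le\<close>). To see this,
cover \<open>E\<close> by an open set of almost the same measure, containing every open set on which \<open>u > t\<close> almost everywhere. A component \<open>J\<close> of it on which \<open>u \<le> t\<close> holds on a
non-null set satisfies $\int_J u \le c\, t\, |J|$ by the $A_1$ condition. On the line every component can be
brought into this situation by an arbitrarily small enlargement (\<open>component_integral_le\<close>).

Integrating the estimate against $t^{\tau-2}\,dt$ gives an inequality between multiples of $\int_I u^\tau$, up to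
a lower order term. The multiple on the left, $1/(\tau-1)$, exceeds the one on the right, $c/\tau$,
precisely if $\tau < c/(c-1)$ (\<open>power_integral_le_of_level_sets\<close>). The result is a reverse Hoelder inequality on \<open>I\<close>.

The range of exponents is optimal on the half-line because of $u(x) = x^{-(1-1/c)}$ and $v = 1$. The $A_1$ constant of
\<open>u\<close> is \<open>c\<close> (\<open>powr_A1_const\<close>), and for $\tau \ge c/(c-1)$ the function $u^\tau$ is at least $1/x$ on \<open>(0, 1)\<close>,
hence not integrable there.\<close>

section \<open>Bounded intervals and averages\<close>

lemma bounded_interval_sandwich:
  assumes "I \<in> bounded_intervals X"
  obtains a b where "a < b" "{a<..<b} \<subseteq> I" "I \<subseteq> {a..b}" "I \<subseteq> X"
proof -
  have I: "is_interval I" "bounded I" "I \<subseteq> X" "0 < measure lebesgue I"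
    using assms by (auto simp: bounded_intervals_def)
  have ne: "I \<noteq> {}"
    using I(4) by auto
  have bdd: "bdd_above I" "bdd_below I"
    using I(2) by (auto simp: bounded_imp_bdd_above bounded_imp_bdd_below)
  have 1: "I \<subseteq> {Inf I..Sup I}"
    using bdd by (auto intro: cInf_lower cSup_upper)
  have 2: "{Inf I<..<Sup I} \<subseteq> I"
  proof
    fix x assume "x \<in> {Inf I<..<Sup I}"
    then have "Inf I < x" "x < Sup I"
      by auto
    then obtain y z where "y \<in> I" "z \<in> I" "y < x" "x < z"
      using cInf_less_iff[OF ne bdd(2), of x] less_cSup_iff[OF ne bdd(1), of x] by blast
    then show "x \<in> I"
      using I(1) unfolding is_interval_1 by (meson less_imp_le)
  qed
  have "Inf I < Sup I"
  proof (rule ccontr)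
    assume "\<not> Inf I < Sup I"
    with 1 have "I \<subseteq> {Inf I}"
      by (auto simp: subset_iff)
    then have "finite I"
      using finite_subset by blast
    then have "I \<in> null_sets lebesgue"
      by (simp add: negligible_finite negligible_iff_null_sets[symmetric])
    with I(4) show False
      by (simp add: measure_eq_0_null_sets)
  qed
  with 1 2 I(3) show thesis
    by (intro that)
qed

lemma open_interval_in_bounded_intervals:
  "a < b \<Longrightarrow> {a<..<b} \<subseteq> X \<Longrightarrow> {a<..<b} \<in> bounded_intervals X"
  by (simp add: bounded_intervals_def)

lemma bounded_interval_lmeasurable:
  assumes "I \<in> bounded_intervals X"
  shows "I \<in> lmeasurable"
  using assms by (auto simp: bounded_intervals_def is_interval_convex_1
    intro: measurable_convex)

lemma bounded_interval_sets: "I \<in> bounded_intervals X \<Longrightarrow> I \<in> sets lebesgue"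
  using bounded_interval_lmeasurable by blast

lemma bounded_interval_measure: "I \<in> bounded_intervals X \<Longrightarrow> 0 < measure lebesgue I"
  by (simp add: bounded_intervals_def)

lemma weight_on_measurable:
  assumes "weight_on X w" "I \<in> bounded_intervals X"
  shows "w \<in> borel_measurable (restrict_space lebesgue I)"
  using assms bounded_interval_sets[OF assms(2)]
  by (auto simp: weight_on_def set_integrable_def borel_measurable_restrict_space_iff
      dest: borel_measurable_integrable)

lemma weight_on_pos: "weight_on X w \<Longrightarrow> I \<in> bounded_intervals X \<Longrightarrow> x \<in> I \<Longrightarrow> 0 < w x"
  by (auto simp: weight_on_def bounded_intervals_def)

lemma set_integral_pos:
  fixes f :: "'a \<Rightarrow> real"
  assumes A: "A \<in> sets M" "0 < measure M A" and f: "set_integrable M A f" "\<And>x. x \<in> A \<Longrightarrow> 0 < f x"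
  shows "0 < set_lebesgue_integral M A f"
proof -
  have nn: "0 \<le> set_lebesgue_integral M A f"
    unfolding set_lebesgue_integral_def
    by (rule Bochner_Integration.integral_nonneg) (auto simp: f(2) less_imp_le split: split_indicator)
  have "set_lebesgue_integral M A f \<noteq> 0"
  proof
    assume "set_lebesgue_integral M A f = 0"
    then have "AE x in M. indicator A x *\<^sub>R f x = 0"
      using f by (subst (asm) set_lebesgue_integral_def, subst (asm) integral_nonneg_eq_0_iff_AE)
        (auto simp: set_integrable_def less_imp_le split: split_indicator)
    then have "AE x in M. x \<notin> A"
      by (rule eventually_mono) (use f(2) in \<open>fastforce split: split_indicator_asm\<close>)
    then have "A \<in> null_sets M"
      using A(1) by (simp add: AE_iff_null_sets)
    then show False
      using A(2) by (simp add: measure_eq_0_null_sets)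
  qed
  with nn show ?thesis by simp
qed

lemma average_pos:
  assumes "weight_on X w" "I \<in> bounded_intervals X"
  shows "0 < average I w"
proof -
  have "0 < set_lebesgue_integral lebesgue I w"
    using assms by (intro set_integral_pos bounded_interval_sets bounded_interval_measure weight_on_pos)
      (auto simp: weight_on_def)
  then show ?thesis
    using bounded_interval_measure[OF assms(2)] by (simp add: average_def)
qed

lemma average_le_iff:
  "I \<in> bounded_intervals X \<Longrightarrow> average I f \<le> c \<longleftrightarrow> set_lebesgue_integral lebesgue I f \<le> c * measure lebesgue I"
  using bounded_interval_measure[of I X] by (simp add: average_def field_simps)

lemma set_integral_const_interval:
  "I \<in> bounded_intervals X \<Longrightarrow> set_lebesgue_integral lebesgue I (\<lambda>_. c :: real) = c * measure lebesgue I"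
  using bounded_interval_sets[of I X]  by (simp add: set_lebesgue_integral_def)

lemma average_mono_AE:
  assumes I: "I \<in> bounded_intervals X"
    and "set_integrable lebesgue I f" "set_integrable lebesgue I g"
    and "AE x\<in>I in lebesgue. f x \<le> g x"
  shows "average I f \<le> average I g"
  using assms set_integral_mono_AE[of lebesgue I f g] bounded_interval_measure[OF I]
  by (auto simp: average_def intro!: divide_right_mono)

lemma average_const:
  "I \<in> bounded_intervals X \<Longrightarrow> average I (\<lambda>_. c) = c"
  using bounded_interval_measure[of I X] by (simp add: average_def set_integral_const_interval)

lemma average_cmult: "average I (\<lambda>x. c * f x) = c * average I f"
  by (simp add: average_def)

lemma set_integrable_const_interval:
  "I \<in> bounded_intervals X \<Longrightarrow> set_integrable lebesgue I (\<lambda>_. c :: real)"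
  using bounded_interval_lmeasurable[of I X] fmeasurableD2[of I lebesgue]
  by (auto simp: set_integrable_def top.not_eq_extremum)

text \<open>An interval differs from its interior by at most two endpoints. Averages may therefore be computed over
open intervals, where the fundamental theorem of calculus and the components of open sets apply.\<close>

lemma bounded_interval_as_open:
  assumes I: "I \<in> bounded_intervals X"
  obtains a b where "a < b" "{a<..<b} \<subseteq> X" "I \<subseteq> {a..b}"
    "\<forall>f\<in>(borel_measurable lebesgue :: (real \<Rightarrow> real) set). set_integrable lebesgue I f \<longleftrightarrow> set_integrable lebesgue {a<..<b} f"
    "\<forall>f\<in>borel_measurable lebesgue. average I f = average {a<..<b} f"
proof -
  obtain a b where ab: "a < b" "{a<..<b} \<subseteq> I" "I \<subseteq> {a..b}" "I \<subseteq> X"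
    using I by (rule bounded_interval_sandwich)
  let ?J = "{a<..<b}"
  have ends: "AE x in lebesgue. x \<notin> {a, b}"
    by (rule AE_not_in) (simp add: negligible_iff_null_sets[symmetric])
  have iff: "x \<in> I \<longleftrightarrow> x \<in> ?J" if "x \<notin> {a, b}" for x
    using ab(2,3) that by fastforce
  have AE: "AE x in lebesgue. x \<in> I \<longleftrightarrow> x \<in> ?J"
    by (rule eventually_mono[OF ends iff])
  have [measurable]: "I \<in> sets lebesgue" "?J \<in> sets lebesgue"
    using bounded_interval_sets[OF I] by simp_all
  show thesis
  proof (rule that[of a b])
    show "\<forall>f\<in>(borel_measurable lebesgue :: (real \<Rightarrow> real) set). set_integrable lebesgue I f \<longleftrightarrow> set_integrable lebesgue ?J f"
    proof
      fix f :: "real \<Rightarrow> real"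
      assume [measurable]: "f \<in> borel_measurable lebesgue"
      show "set_integrable lebesgue I f \<longleftrightarrow> set_integrable lebesgue ?J f"
        unfolding set_integrable_def
        by (rule integrable_cong_AE, measurable, rule eventually_mono[OF AE], simp add: indicator_def)
    qed
    show "\<forall>f\<in>borel_measurable lebesgue. average I f = average ?J f"
    proof
      fix f :: "real \<Rightarrow> real"
      assume [measurable]: "f \<in> borel_measurable lebesgue"
      have "set_lebesgue_integral lebesgue I f = set_lebesgue_integral lebesgue ?J f"
        using AE by (intro set_integral_cong_set) (auto simp: set_borel_measurable_def)
      moreover have "measure lebesgue I = measure lebesgue ?J"
        using AE by (intro measure_eq_AE) simp_all
      ultimately show "average I f = average ?J f"
        by (simp add: average_def)
    qed
  qed (use ab in auto)
qed

section \<open>The $A_1$ condition as a pointwise inequality\<close>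

lemma le_essinf_on_iff:
  assumes "I \<in> sets lebesgue" "f \<in> borel_measurable (restrict_space lebesgue I)"
  shows "ereal m \<le> essinf_on I f \<longleftrightarrow> (AE x\<in>I in lebesgue. m \<le> f x)"
proof -
  let ?M = "restrict_space lebesgue I"
  have meas: "(\<lambda>x. - ereal (f x)) \<in> borel_measurable ?M"
    using assms by measurable
  have "ereal m \<le> essinf_on I f \<longleftrightarrow> esssup ?M (\<lambda>x. - ereal (f x)) \<le> - ereal m"
    unfolding essinf_on_def by (metis ereal_minus_le_minus ereal_uminus_uminus)
  also have "\<dots> \<longleftrightarrow> (AE x in ?M. - ereal (f x) \<le> - ereal m)"
  proof
    assume *: "esssup ?M (\<lambda>x. - ereal (f x)) \<le> - ereal m"
    show "AE x in ?M. - ereal (f x) \<le> - ereal m"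
      using esssup_AE[of "\<lambda>x. - ereal (f x)" ?M] by (rule eventually_mono) (use * in \<open>blast intro: order_trans\<close>)
  qed (rule esssup_I[OF meas])
  also have "\<dots> \<longleftrightarrow> (AE x\<in>I in lebesgue. m \<le> f x)"
    using assms(1) by (subst AE_restrict_space_iff) auto
  finally show ?thesis .
qed

text \<open>A lower bound for the essential infimum is an almost everywhere lower bound. Every later argument
uses the $A_1$ condition in this form.\<close>

lemma A1_bounds_iff:
  assumes w: "weight_on X w" and c: "0 < c"
  shows "c \<in> A1_bounds X w \<longleftrightarrow>
    (\<forall>I\<in>bounded_intervals X. AE x\<in>I in lebesgue. average I w \<le> c * w x)"
proof -
  have "ereal (average I w) \<le> ereal c * essinf_on I w \<longleftrightarrow>
      (AE x\<in>I in lebesgue. average I w \<le> c * w x)" if I: "I \<in> bounded_intervals X" for I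
  proof -
    have "ereal (average I w) \<le> ereal c * essinf_on I w \<longleftrightarrow> ereal (average I w / c) \<le> essinf_on I w"
      using c by (cases "essinf_on I w") (auto simp: field_simps)
    also have "\<dots> \<longleftrightarrow> (AE x\<in>I in lebesgue. average I w / c \<le> w x)"
      using I w by (intro le_essinf_on_iff bounded_interval_sets weight_on_measurable)
    also have "\<dots> \<longleftrightarrow> (AE x\<in>I in lebesgue. average I w \<le> c * w x)"
      using c by (simp add: field_simps)
    finally show ?thesis .
  qed
  then show ?thesis
    unfolding A1_bounds_def by blast
qed

text \<open>Integrating the pointwise inequality over \<open>I\<close> compares the positive average with \<open>c\<close> times itself. A nonpositive
constant has to be excluded beforehand, because the pointwise form presupposes \<open>0 < c\<close>; it fails since the
right-hand side of the bound would be nonpositive while the average is positive.\<close>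

lemma A1_bounds_ge_1:
  assumes w: "weight_on X w" and c: "c \<in> A1_bounds X w" and I: "I \<in> bounded_intervals X"
  shows "1 \<le> c"
proof -
  have avg: "0 < average I w"
    using w I by (rule average_pos)
  have "0 < c"
  proof (rule ccontr)
    assume "\<not> 0 < c"
    have "ereal 0 \<le> essinf_on I w"
      using weight_on_pos[OF w I]
      by (subst le_essinf_on_iff[OF bounded_interval_sets[OF I] weight_on_measurable[OF w I]])
        (auto simp: less_imp_le)
    then have "ereal c * essinf_on I w \<le> 0"
      using \<open>\<not> 0 < c\<close> by (cases "essinf_on I w") (auto simp: mult_le_0_iff)
    moreover have "ereal (average I w) \<le> ereal c * essinf_on I w"
      using c I by (simp add: A1_bounds_def)
    ultimately show False
      using avg by (meson ereal_less(2) leD order_trans)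
  qed
  then have AE: "AE x\<in>I in lebesgue. average I w \<le> c * w x"
    using A1_bounds_iff[OF w, of c] c I by simp
  have "average I (\<lambda>_. average I w) \<le> average I (\<lambda>x. c * w x)"
    using w I by (intro average_mono_AE[OF I _ _ AE] set_integrable_const_interval[OF I] set_integrable_mult_right)
       (auto simp: weight_on_def)
  then have "average I w \<le> c * average I w"
    by (simp add: average_const[OF I] average_cmult)
  with avg show ?thesis
    by simp
qed

lemma A_1_AE_bound:
  assumes "A_1 X w"
  obtains c where "1 \<le> c" "\<And>I. I \<in> bounded_intervals X \<Longrightarrow> AE x\<in>I in lebesgue. average I w \<le> c * w x"
proof (cases "bounded_intervals X = {}")
  case True
  then show thesis
    by (intro that[of 1]) auto
next
  case False
  with assms obtain I c where I: "I \<in> bounded_intervals X" and c: "c \<in> A1_bounds X w"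
    and w: "weight_on X w"
    unfolding A_1_def by blast
  have "1 \<le> c"
    using A1_bounds_ge_1[OF w c I] .
  moreover from this have "\<forall>I\<in>bounded_intervals X. AE x\<in>I in lebesgue. average I w \<le> c * w x"
    using A1_bounds_iff[OF w, of c] c by simp
  ultimately show thesis
    by (intro that[of c]) auto
qed

section \<open>Pairs of $A_1$ weights give $A_p$ weights\<close>

lemma set_integrable_of_AE_bound:
  fixes f g :: "real \<Rightarrow> real"
  assumes I: "I \<in> sets lebesgue" and f: "f \<in> borel_measurable (restrict_space lebesgue I)"
    and g: "set_integrable lebesgue I g"
    and nn: "\<And>x. x \<in> I \<Longrightarrow> 0 \<le> f x" and bd: "AE x\<in>I in lebesgue. f x \<le> g x"
  shows "set_integrable lebesgue I f"
proof (rule set_integrable_bound[OF g])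
  show "set_borel_measurable lebesgue I f"
    using f I by (simp add: set_borel_measurable_def borel_measurable_restrict_space_iff)
  show "AE x in lebesgue. x \<in> I \<longrightarrow> norm (f x) \<le> norm (g x)"
    using bd by (rule eventually_mono) (use nn in fastforce)
qed

lemma set_borel_measurable_iff_restrict:
  fixes f :: "real \<Rightarrow> real"
  assumes "X \<in> sets lebesgue"
  shows "set_borel_measurable lebesgue X f \<longleftrightarrow> f \<in> borel_measurable (restrict_space lebesgue X)"
  using assms by (simp add: set_borel_measurable_def borel_measurable_restrict_space_iff)

text \<open>The easy half of the factorization of $A_p$ weights. The factor with the negative exponent is bounded above
on an interval by a power of the essential lower bound which $A_1$ provides. For \<open>w\<close> this removes \<open>v\<close>,
and for $w^{1-p'} = u^{1-p'} v$ it removes \<open>u\<close>. What remains are averages of \<open>u\<close> and \<open>v\<close>, which cancel.\<close>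

lemma A_p_of_A_1:
  assumes p: "1 < p" and u: "A_1 X u" and v: "A_1 X v" and X: "X \<in> sets lebesgue"
  shows "A_p X p (\<lambda>x. u x * v x powr (1 - p))"
proof -
  define p' where "p' = p / (p - 1)"
  define w where "w = (\<lambda>x. u x * v x powr (1 - p))"
  define \<sigma> where "\<sigma> = (\<lambda>x. w x powr (1 - p'))"
  have p'_neg: "1 - p' < 0" and p'_exp: "(1 - p) * (1 - p') = 1" "(1 - p') * (p - 1) = -1"
    using p by (simp_all add: p'_def field_simps)
  obtain cu where cu: "1 \<le> cu"
    and A1u: "\<And>I. I \<in> bounded_intervals X \<Longrightarrow> AE x\<in>I in lebesgue. average I u \<le> cu * u x"
    using A_1_AE_bound[OF u] by blast
  obtain cv where cv: "1 \<le> cv"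
    and A1v: "\<And>I. I \<in> bounded_intervals X \<Longrightarrow> AE x\<in>I in lebesgue. average I v \<le> cv * v x"
    using A_1_AE_bound[OF v] by blast
  have wu: "weight_on X u" and wv: "weight_on X v"
    using u v by (auto simp: A_1_def)
  have key: "set_integrable lebesgue I w \<and> set_integrable lebesgue I \<sigma> \<and>
      average I w * average I \<sigma> powr (p - 1) \<le> cu * cv powr (p - 1)"
    if I: "I \<in> bounded_intervals X" for I
  proof -
    note [measurable] = weight_on_measurable[OF wu I] weight_on_measurable[OF wv I]
    define mu where "mu = average I u / cu"
    define mv where "mv = average I v / cv"
    have pos: "0 < average I u" "0 < average I v"
      using average_pos[OF wu I] average_pos[OF wv I] .
    have mpos: "0 < mu" "0 < mv"
      using pos cu cv by (simp_all add: mu_def mv_def)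
    have AEu: "AE x\<in>I in lebesgue. mu \<le> u x" and AEv: "AE x\<in>I in lebesgue. mv \<le> v x"
      using A1u[OF I] A1v[OF I] cu cv by (simp_all add: mu_def mv_def field_simps)
    have int: "set_integrable lebesgue I u" "set_integrable lebesgue I v"
      using wu wv I by (auto simp: weight_on_def)
    have \<sigma>_eq: "\<sigma> x = u x powr (1 - p') * v x" if "x \<in> I" for x
      using weight_on_pos[OF wu I that] weight_on_pos[OF wv I that] p'_exp
      by (simp add: \<sigma>_def w_def powr_mult powr_powr)
    have w_bd: "AE x\<in>I in lebesgue. w x \<le> mv powr (1 - p) * u x"
      using AEv
    proof (rule eventually_mono, intro impI)
      fix x assume x: "x \<in> I \<longrightarrow> mv \<le> v x" "x \<in> I"
      then have "v x powr (1 - p) \<le> mv powr (1 - p)"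
        using p mpos by (intro powr_mono2') auto
      then show "w x \<le> mv powr (1 - p) * u x"
        using weight_on_pos[OF wu I x(2)] by (simp add: w_def mult.commute)
    qed
    have \<sigma>_bd: "AE x\<in>I in lebesgue. \<sigma> x \<le> mu powr (1 - p') * v x"
      using AEu
    proof (rule eventually_mono, intro impI)
      fix x assume x: "x \<in> I \<longrightarrow> mu \<le> u x" "x \<in> I"
      then have "u x powr (1 - p') \<le> mu powr (1 - p')"
        using p'_neg mpos by (intro powr_mono2') auto
      then show "\<sigma> x \<le> mu powr (1 - p') * v x"
        using weight_on_pos[OF wv I x(2)] by (simp add: \<sigma>_eq[OF x(2)])
    qed
    have w_int: "set_integrable lebesgue I w"
    proof (rule set_integrable_of_AE_bound[OF bounded_interval_sets[OF I] _ _ _ w_bd])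
      show "w \<in> borel_measurable (restrict_space lebesgue I)"
        unfolding w_def by measurable
      show "0 \<le> w x" if "x \<in> I" for x
        using weight_on_pos[OF wu I that] by (simp add: w_def)
    qed (use int in simp)
    have \<sigma>_int: "set_integrable lebesgue I \<sigma>"
    proof (rule set_integrable_of_AE_bound[OF bounded_interval_sets[OF I] _ _ _ \<sigma>_bd])
      show "\<sigma> \<in> borel_measurable (restrict_space lebesgue I)"
        unfolding \<sigma>_def w_def by measurable
      show "0 \<le> \<sigma> x" for x
        by (simp add: \<sigma>_def)
    qed (use int in simp)
    have w_avg: "average I w \<le> mv powr (1 - p) * average I u"
      using average_mono_AE[OF I w_int _ w_bd] int by (simp add: average_cmult)
    have \<sigma>_avg: "average I \<sigma> \<le> mu powr (1 - p') * average I v"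
      using average_mono_AE[OF I \<sigma>_int _ \<sigma>_bd] int by (simp add: average_cmult)
    have \<sigma>_nn: "0 \<le> average I \<sigma>"
      by (auto simp: average_def set_lebesgue_integral_def \<sigma>_def intro!: divide_nonneg_nonneg)
    have "average I w * average I \<sigma> powr (p - 1)
        \<le> (mv powr (1 - p) * average I u) * (mu powr (1 - p') * average I v) powr (p - 1)"
      using w_avg \<sigma>_avg \<sigma>_nn pos p by (intro mult_mono powr_mono2) auto
    also have "\<dots> = (average I u / mu) * (average I v / mv) powr (p - 1)"
    proof -
      have "(mu powr (1 - p') * average I v) powr (p - 1) = average I v powr (p - 1) / mu"
        using mpos pos p'_exp(2) by (simp add: powr_mult powr_powr powr_minus_divide)
      moreover have "mv powr (1 - p) = 1 / mv powr (p - 1)"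
        using powr_minus_divide[of mv "p - 1"] by simp
      ultimately show ?thesis
        using mpos pos by (simp add: powr_divide)
    qed
    also have "\<dots> = cu * cv powr (p - 1)"
      using pos cu cv by (simp add: mu_def mv_def)
    finally show ?thesis
      using w_int \<sigma>_int by simp
  qed
  have "weight_on X w"
    unfolding weight_on_def
  proof (intro conjI ballI)
    show "0 < w x" if "x \<in> X" for x
      using that wu wv unfolding weight_on_def w_def by (metis less_irrefl mult_pos_pos powr_gt_zero)
    have "u \<in> borel_measurable (restrict_space lebesgue X)" "v \<in> borel_measurable (restrict_space lebesgue X)"
      using wu wv X by (simp_all add: weight_on_def set_borel_measurable_iff_restrict)
    then show "set_borel_measurable lebesgue X w"
      unfolding set_borel_measurable_iff_restrict[OF X] w_def by measurable
  qed (use key in blast)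
  then show ?thesis
    using key unfolding A_p_def Let_def p'_def[symmetric] w_def[symmetric] \<sigma>_def[symmetric]
    by blast
qed

section \<open>From level sets to powers\<close>

lemma nn_integral_powr_Icc:
  fixes a b s :: real
  assumes "0 < a" "a \<le> b" "s \<noteq> 0"
  shows "(\<integral>\<^sup>+ t. ennreal (t powr (s - 1)) * indicator {a..b} t \<partial>lborel) = ennreal ((b powr s - a powr s) / s)"
proof (rule nn_integral_has_integral_lebesgue')
  have "((\<lambda>t. t powr (s - 1)) has_integral (b powr s / s - a powr s / s)) {a..b}"
    using assms
    by (intro fundamental_theorem_of_calculus)
       (auto intro!: derivative_eq_intros simp: has_real_derivative_iff_has_vector_derivative[symmetric])
  then show "((\<lambda>t. t powr (s - 1)) has_integral ((b powr s - a powr s) / s)) {a..b}"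
    by (simp add: diff_divide_distrib)
qed simp

text \<open>Fubini's theorem for the level sets of \<open>u\<close>: at a point \<open>x\<close>, the levels \<open>t\<close> in $[m,k]$ that lie below \<open>u x\<close>
form an interval from \<open>m\<close> to the truncation of \<open>u x\<close>. The density \<open>g\<close> is kept general because the level set
hypothesis below compares the cases \<open>g = u\<close> and \<open>g = 1\<close>.\<close>

lemma (in finite_measure) truncated_layer_cake:
  fixes u :: "'a \<Rightarrow> real"
  assumes u[measurable]: "u \<in> borel_measurable M" and g[measurable]: "g \<in> borel_measurable M"
    and m: "0 < m" "m \<le> k" and s: "s \<noteq> 0"
  shows "(\<integral>\<^sup>+ t. ennreal (t powr (s - 1)) * indicator {m..k} t *
        (\<integral>\<^sup>+ x. g x * indicator {x \<in> space M. t < u x} x \<partial>M) \<partial>lborel) =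
      (\<integral>\<^sup>+ x. g x * ennreal ((max m (min (u x) k) powr s - m powr s) / s) \<partial>M)"
proof -
  interpret pair_sigma_finite M lborel ..
  let ?f = "\<lambda>x t. ennreal (t powr (s - 1)) * indicator {m..k} t * (g x * indicator {x \<in> space M. t < u x} x)"
  let ?h = "\<lambda>x t. ennreal (t powr (s - 1)) * indicator {m..k} t * (g x * (if t < u x then 1 else 0))"
  have [measurable]: "(\<lambda>(x, t). ?h x t) \<in> borel_measurable (M \<Otimes>\<^sub>M lborel)"
    by measurable
  have fh: "?f x t = ?h x t" if "x \<in> space M" for x t
    using that by (simp add: indicator_def)
  have "(\<integral>\<^sup>+ t. ennreal (t powr (s - 1)) * indicator {m..k} t *
        (\<integral>\<^sup>+ x. g x * indicator {x \<in> space M. t < u x} x \<partial>M) \<partial>lborel) =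
      (\<integral>\<^sup>+ t. (\<integral>\<^sup>+ x. ?f x t \<partial>M) \<partial>lborel)"
    by (intro nn_integral_cong nn_integral_cmult[symmetric]) measurable
  also have "\<dots> = (\<integral>\<^sup>+ t. (\<integral>\<^sup>+ x. ?h x t \<partial>M) \<partial>lborel)"
    by (intro nn_integral_cong fh)
  also have "\<dots> = (\<integral>\<^sup>+ x. (\<integral>\<^sup>+ t. ?h x t \<partial>lborel) \<partial>M)"
    by (rule Fubini') measurable
  also have "\<dots> = (\<integral>\<^sup>+ x. g x * ennreal ((max m (min (u x) k) powr s - m powr s) / s) \<partial>M)"
  proof (rule nn_integral_cong)
    fix x
    let ?\<phi> = "max m (min (u x) k)"
    have "AE t in lborel. t \<noteq> u x \<and> t \<noteq> m"
      by (intro AE_conjI AE_lborel_singleton)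
    then have "(\<integral>\<^sup>+ t. ?h x t \<partial>lborel) = (\<integral>\<^sup>+ t. g x * (ennreal (t powr (s - 1)) * indicator {m..?\<phi>} t) \<partial>lborel)"
      by (intro nn_integral_cong_AE, eventually_elim) (auto simp: indicator_def mult_ac)
    also have "\<dots> = g x * (\<integral>\<^sup>+ t. ennreal (t powr (s - 1)) * indicator {m..?\<phi>} t \<partial>lborel)"
      by (intro nn_integral_cmult) measurable
    also have "\<dots> = g x * ennreal ((?\<phi> powr s - m powr s) / s)"
      using m s by (subst nn_integral_powr_Icc) auto
    finally show "(\<integral>\<^sup>+ t. ?h x t \<partial>lborel) = g x * ennreal ((?\<phi> powr s - m powr s) / s)" .
  qed
  finally show ?thesis .
qed

text \<open>Multiply the level set inequality by $t^{\tau-2}$ and integrate over $t \in [m,k]$. With \<open>\<phi>\<close> the truncation of \<open>u\<close>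
to $[m,k]$, $A = \int u \phi^{\tau-1}$ and $U = \int u$, the left-hand side is $(A - m^{\tau-1} U)/(\tau-1)$, and
the right-hand side is at most $cA/\tau$. Exactly when $c(\tau-1) < \tau$, that is $\tau < c/(c-1)$, the term with \<open>A\<close>
can be absorbed on the left. Truncation makes \<open>A\<close> finite, without which absorbing would prove nothing.\<close>

lemma (in finite_measure) truncated_power_integral_le:
  fixes u :: "'a \<Rightarrow> real"
  assumes u: "integrable M u" "\<And>x. 0 \<le> u x"
    and m: "0 < m" "m \<le> k" and c: "0 \<le> c" and \<tau>: "1 < \<tau>" "c * (\<tau> - 1) < \<tau>"
    and level: "\<And>t. m < t \<Longrightarrow>
      (\<integral>x. u x * indicator {x \<in> space M. t < u x} x \<partial>M) \<le> c * t * measure M {x \<in> space M. t < u x}"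
  shows "integrable M (\<lambda>x. u x * max m (min (u x) k) powr (\<tau> - 1))" (is ?int)
    and "(\<integral>x. u x * max m (min (u x) k) powr (\<tau> - 1) \<partial>M)
      \<le> \<tau> / (\<tau> - c * (\<tau> - 1)) * m powr (\<tau> - 1) * (\<integral>x. u x \<partial>M)" (is ?bd)
proof -
  let ?\<phi> = "\<lambda>x. max m (min (u x) k)"
  have [measurable]: "u \<in> borel_measurable M"
    using u(1) by simp
  have \<phi>: "m \<le> ?\<phi> x" "?\<phi> x \<le> k" "0 < ?\<phi> x" for x
    using m by auto
  have \<phi>1: "m powr (\<tau> - 1) \<le> ?\<phi> x powr (\<tau> - 1)" "?\<phi> x powr (\<tau> - 1) \<le> k powr (\<tau> - 1)" for x
    using \<phi>[of x] m \<tau> by (auto intro!: powr_mono2)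
  have \<phi>2: "m powr \<tau> \<le> ?\<phi> x powr \<tau>" "?\<phi> x powr \<tau> \<le> k powr \<tau>" for x
    using \<phi>[of x] m \<tau> by (auto intro!: powr_mono2)
  show int: ?int
  proof (rule Bochner_Integration.integrable_bound)
    show "integrable M (\<lambda>x. k powr (\<tau> - 1) * u x)"
      using u by simp
    show "AE x in M. norm (u x * ?\<phi> x powr (\<tau> - 1)) \<le> norm (k powr (\<tau> - 1) * u x)"
      using u(2) \<phi>1 by (intro AE_I2) (auto simp: abs_mult mult.commute[of "k powr _"] intro!: mult_left_mono)
  qed measurable
  have int2: "integrable M (\<lambda>x. (?\<phi> x powr \<tau> - m powr \<tau>) / \<tau>)"
  proof (rule integrable_const_bound[where B = "k powr \<tau> / \<tau>"])
    show "AE x in M. norm ((?\<phi> x powr \<tau> - m powr \<tau>) / \<tau>) \<le> k powr \<tau> / \<tau>"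
    proof (rule AE_I2)
      fix x
      have "0 \<le> ?\<phi> x powr \<tau> - m powr \<tau>" "?\<phi> x powr \<tau> - m powr \<tau> \<le> k powr \<tau>"
        using \<phi>2[of x] powr_ge_zero[of m \<tau>] by linarith+
      then show "norm ((?\<phi> x powr \<tau> - m powr \<tau>) / \<tau>) \<le> k powr \<tau> / \<tau>"
        using \<tau> by (simp add: divide_right_mono)
    qed
  qed measurable
  have int1: "integrable M (\<lambda>x. u x * ((?\<phi> x powr (\<tau> - 1) - m powr (\<tau> - 1)) / (\<tau> - 1)))"
    using int u(1) by (simp add: right_diff_distrib diff_divide_distrib)
  define U where "U = (\<integral>x. u x \<partial>M)"
  define A where "A = (\<integral>x. u x * ?\<phi> x powr (\<tau> - 1) \<partial>M)"
  define B where "B = (\<integral>x. (?\<phi> x powr \<tau> - m powr \<tau>) / \<tau> \<partial>M)"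
  have "ennreal (\<integral>x. u x * ((?\<phi> x powr (\<tau> - 1) - m powr (\<tau> - 1)) / (\<tau> - 1)) \<partial>M)
      = (\<integral>\<^sup>+ x. ennreal (u x * ((?\<phi> x powr (\<tau> - 1) - m powr (\<tau> - 1)) / (\<tau> - 1))) \<partial>M)"
    using u(2) \<phi>1 \<tau> by (intro nn_integral_eq_integral[symmetric] int1 AE_I2) simp
  also have "\<dots> = (\<integral>\<^sup>+ x. ennreal (u x) * ennreal ((?\<phi> x powr (\<tau> - 1) - m powr (\<tau> - 1)) / (\<tau> - 1)) \<partial>M)"
    using u(2) \<phi>1 \<tau> by (intro nn_integral_cong ennreal_mult) auto
  also have "\<dots> = (\<integral>\<^sup>+ t. ennreal (t powr (\<tau> - 1 - 1)) * indicator {m..k} t *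
        (\<integral>\<^sup>+ x. ennreal (u x) * indicator {x \<in> space M. t < u x} x \<partial>M) \<partial>lborel)"
    using m \<tau> by (intro truncated_layer_cake[symmetric]) auto
  also have "\<dots> \<le> (\<integral>\<^sup>+ t. ennreal c * (ennreal (t powr (\<tau> - 1)) * indicator {m..k} t *
        (\<integral>\<^sup>+ x. 1 * indicator {x \<in> space M. t < u x} x \<partial>M)) \<partial>lborel)"
  \<comment> \<open>The hypothesis covers levels above \<open>m\<close> only; the level \<open>m\<close> itself is a null set.\<close>
  proof (rule nn_integral_mono_AE, rule eventually_mono[OF AE_lborel_singleton])
    fix t :: real assume "t \<noteq> m"
    let ?E = "{x \<in> space M. t < u x}"
    show "ennreal (t powr (\<tau> - 1 - 1)) * indicator {m..k} t * (\<integral>\<^sup>+ x. ennreal (u x) * indicator ?E x \<partial>M)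
      \<le> ennreal c * (ennreal (t powr (\<tau> - 1)) * indicator {m..k} t * (\<integral>\<^sup>+ x. 1 * indicator ?E x \<partial>M))"
    proof (cases "t \<in> {m..k}")
      case True
      with \<open>t \<noteq> m\<close> m have t: "m < t" "0 < t" by auto
      have "(\<integral>\<^sup>+ x. ennreal (u x) * indicator ?E x \<partial>M) = (\<integral>\<^sup>+ x. ennreal (u x * indicator ?E x) \<partial>M)"
        by (intro nn_integral_cong) (simp split: split_indicator)
      also have "\<dots> = ennreal (\<integral>x. u x * indicator ?E x \<partial>M)"
        using u by (intro nn_integral_eq_integral integrable_real_mult_indicator) auto
      also have "\<dots> \<le> ennreal (c * t * measure M ?E)"
        using level[OF t(1)] by (rule ennreal_leI)
      also have "\<dots> = ennreal c * ennreal t * (\<integral>\<^sup>+ x. 1 * indicator ?E x \<partial>M)"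
        using c t by (simp add: ennreal_mult emeasure_eq_measure)
      finally have "ennreal (t powr (\<tau> - 1 - 1)) * (\<integral>\<^sup>+ x. ennreal (u x) * indicator ?E x \<partial>M)
          \<le> ennreal (t powr (\<tau> - 1 - 1)) * (ennreal c * ennreal t * (\<integral>\<^sup>+ x. 1 * indicator ?E x \<partial>M))"
        by (rule mult_left_mono) simp
      also have "\<dots> = ennreal c * (ennreal (t powr (\<tau> - 1 - 1)) * ennreal t) * (\<integral>\<^sup>+ x. 1 * indicator ?E x \<partial>M)"
        by (simp add: mult_ac)
      also have "ennreal (t powr (\<tau> - 1 - 1)) * ennreal t = ennreal (t powr (\<tau> - 1))"
        using t powr_add[of t "\<tau> - 1 - 1" 1] by (simp add: ennreal_mult[symmetric])
      finally show ?thesis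
        using True by (simp add: mult_ac)
    qed simp
  qed
  also have "\<dots> = ennreal c * (\<integral>\<^sup>+ t. ennreal (t powr (\<tau> - 1)) * indicator {m..k} t *
        (\<integral>\<^sup>+ x. 1 * indicator {x \<in> space M. t < u x} x \<partial>M) \<partial>lborel)"
    by (rule nn_integral_cmult) measurable
  also have "\<dots> = ennreal c * (\<integral>\<^sup>+ x. 1 * ennreal ((?\<phi> x powr \<tau> - m powr \<tau>) / \<tau>) \<partial>M)"
    using m \<tau> by (subst truncated_layer_cake) auto
  also have "\<dots> = ennreal c * ennreal B"
    unfolding B_def mult_1 using \<phi>2 \<tau> by (subst nn_integral_eq_integral[OF int2]) auto
  also have "\<dots> = ennreal (c * B)"
    using c \<phi>2 \<tau> by (intro ennreal_mult[symmetric]) (auto simp: B_def)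
  finally have "(\<integral>x. u x * ((?\<phi> x powr (\<tau> - 1) - m powr (\<tau> - 1)) / (\<tau> - 1)) \<partial>M) \<le> c * B"
    using c \<phi>2 \<tau> by (subst (asm) ennreal_le_iff) (auto simp: B_def intro!: mult_nonneg_nonneg)
  moreover have "(\<integral>x. u x * ((?\<phi> x powr (\<tau> - 1) - m powr (\<tau> - 1)) / (\<tau> - 1)) \<partial>M)
      = (A - m powr (\<tau> - 1) * U) / (\<tau> - 1)"
    using int u(1) by (simp add: A_def U_def right_diff_distrib mult.commute)
  ultimately have 1: "(A - m powr (\<tau> - 1) * U) / (\<tau> - 1) \<le> c * B"
    by linarith
  have "B \<le> (\<integral>x. u x * ?\<phi> x powr (\<tau> - 1) / \<tau> \<partial>M)"
    unfolding B_def
  proof (rule integral_mono[OF int2])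
    fix x
    have "?\<phi> x powr \<tau> - m powr \<tau> \<le> u x * ?\<phi> x powr (\<tau> - 1)"
    proof (cases "u x < m")
      case True
      then have "?\<phi> x = m"
        by simp
      then show ?thesis
        using u(2)[of x] by simp
    next
      case False
      have "?\<phi> x powr \<tau> = ?\<phi> x * ?\<phi> x powr (\<tau> - 1)"
        using \<phi>[of x] powr_add[of "?\<phi> x" 1 "\<tau> - 1"] by simp
      also have "\<dots> \<le> u x * ?\<phi> x powr (\<tau> - 1)"
        using False by (intro mult_right_mono) auto
      finally show ?thesis
        using powr_ge_zero[of m \<tau>] by linarith
    qed
    then show "(?\<phi> x powr \<tau> - m powr \<tau>) / \<tau> \<le> u x * ?\<phi> x powr (\<tau> - 1) / \<tau>"
      using \<tau> by (simp add: divide_right_mono)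
  qed (use int in simp)
  then have 2: "B \<le> A / \<tau>"
    by (simp add: A_def)
  have "(A - m powr (\<tau> - 1) * U) / (\<tau> - 1) \<le> c * (A / \<tau>)"
    using 1 mult_left_mono[OF 2 c] by linarith
  then have "A * (\<tau> - c * (\<tau> - 1)) \<le> \<tau> * (m powr (\<tau> - 1) * U)"
    using \<tau> by (simp add: field_simps)
  then show ?bd
    using \<tau> by (simp add: A_def[symmetric] U_def[symmetric] pos_le_divide_eq mult.assoc)
qed

text \<open>The truncated bound does not depend on the truncation level, so Fatou's lemma removes it.\<close>

lemma (in finite_measure) power_integral_le_of_level_sets:
  fixes u :: "'a \<Rightarrow> real"
  assumes u: "integrable M u" "\<And>x. 0 \<le> u x"
    and m: "0 < m" and c: "0 \<le> c" and \<tau>: "1 < \<tau>" "c * (\<tau> - 1) < \<tau>"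
    and level: "\<And>t. m < t \<Longrightarrow>
      (\<integral>x. u x * indicator {x \<in> space M. t < u x} x \<partial>M) \<le> c * t * measure M {x \<in> space M. t < u x}"
  shows "integrable M (\<lambda>x. u x powr \<tau>)"
    and "(\<integral>x. u x powr \<tau> \<partial>M) \<le> \<tau> / (\<tau> - c * (\<tau> - 1)) * m powr (\<tau> - 1) * (\<integral>x. u x \<partial>M)"
proof -
  let ?K = "\<tau> / (\<tau> - c * (\<tau> - 1)) * m powr (\<tau> - 1) * (\<integral>x. u x \<partial>M)"
  have [measurable]: "u \<in> borel_measurable M"
    using u(1) by simp
  have K: "0 \<le> ?K"
    using \<tau> u by auto
  let ?f = "\<lambda>n x. u x * max m (min (u x) (m + real n)) powr (\<tau> - 1)"
  have "(\<integral>\<^sup>+ x. ennreal (u x powr \<tau>) \<partial>M) \<le> (\<integral>\<^sup>+ x. liminf (\<lambda>n. ennreal (?f n x)) \<partial>M)"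
  proof (rule nn_integral_mono)
    fix x
    obtain N :: nat where N: "u x \<le> real N"
      using real_arch_simple by blast
    have "ennreal (u x powr \<tau>) \<le> ennreal (?f n x)" if "N \<le> n" for n
    proof (rule ennreal_leI)
      have le: "u x \<le> max m (min (u x) (m + real n))"
        using N that m by auto
      have "u x powr \<tau> = u x * u x powr (\<tau> - 1)"
        using u(2)[of x] powr_add[of "u x" 1 "\<tau> - 1"] by simp
      also have "\<dots> \<le> ?f n x"
        using u(2)[of x] \<tau> le by (intro mult_left_mono powr_mono2) auto
      finally show "u x powr \<tau> \<le> ?f n x" .
    qed
    then show "ennreal (u x powr \<tau>) \<le> liminf (\<lambda>n. ennreal (?f n x))"
      by (intro Liminf_bounded eventually_sequentiallyI)
  qed
  also have "\<dots> \<le> liminf (\<lambda>n. \<integral>\<^sup>+ x. ennreal (?f n x) \<partial>M)"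
    by (rule nn_integral_liminf) measurable
  also have "\<dots> \<le> limsup (\<lambda>n. \<integral>\<^sup>+ x. ennreal (?f n x) \<partial>M)"
    by (rule Liminf_le_Limsup) simp
  also have "\<dots> \<le> ennreal ?K"
  proof (rule Limsup_bounded, rule always_eventually, rule allI)
    fix n :: nat
    have "m \<le> m + real n"
      by simp
    note bd = truncated_power_integral_le[OF u m this c \<tau> level]
    have "(\<integral>\<^sup>+ x. ennreal (?f n x) \<partial>M) = ennreal (\<integral>x. ?f n x \<partial>M)"
      using u(2) by (intro nn_integral_eq_integral bd(1) AE_I2) auto
    also have "\<dots> \<le> ennreal ?K"
      by (rule ennreal_leI[OF bd(2)])
    finally show "(\<integral>\<^sup>+ x. ennreal (?f n x) \<partial>M) \<le> ennreal ?K" .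
  qed
  finally have *: "(\<integral>\<^sup>+ x. ennreal (u x powr \<tau>) \<partial>M) \<le> ennreal ?K" .
  show int: "integrable M (\<lambda>x. u x powr \<tau>)"
    using * by (intro integrableI_nonneg) (auto simp: less_top[symmetric] top_unique)
  show "(\<integral>x. u x powr \<tau> \<partial>M) \<le> ?K"
    using * K by (subst (asm) nn_integral_eq_integral[OF int]) auto
qed

section \<open>The sharp level set estimate\<close>

lemma le_mult_if_le_mult_add:
  fixes K x y :: real
  assumes K: "0 \<le> K" and le: "\<And>\<epsilon>. 0 < \<epsilon> \<Longrightarrow> x \<le> K * (y + \<epsilon>)"
  shows "x \<le> K * y"
proof (cases "K = 0")
  case False
  with K have "0 < K" by simp
  show ?thesis
  proof (rule field_le_epsilon)
    show "x \<le> K * y + e" if "0 < e" for e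
      using le[of "e / K"] that \<open>0 < K\<close> by (simp add: distrib_left)
  qed
qed (use le[of 1] in simp)

text \<open>On an interval where \<open>u \<le> t\<close> holds on a non-null set, the $A_1$ inequality holds at one such point.\<close>

lemma set_integral_le_of_low_points:
  assumes u: "weight_on UNIV u"
    and A1: "AE x\<in>K in lebesgue. average K u \<le> c * u x" and c: "0 \<le> c"
    and K: "K \<in> bounded_intervals UNIV" and low: "\<not> negligible {x \<in> K. u x \<le> t}"
  shows "set_lebesgue_integral lebesgue K u \<le> c * t * measure lebesgue K"
proof -
  have "\<exists>x\<in>K. u x \<le> t \<and> average K u \<le> c * u x"
  proof (rule ccontr)
    assume "\<not> ?thesis"
    then have ae: "AE x in lebesgue. x \<notin> {x \<in> K. u x \<le> t}"
      using A1 by (elim eventually_mono) auto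
    obtain N where N: "\<And>x. x \<in> space lebesgue - N \<Longrightarrow> x \<notin> {x \<in> K. u x \<le> t}" "N \<in> null_sets lebesgue"
      by (rule AE_E3[OF ae], rule that)
    then have "{x \<in> K. u x \<le> t} \<subseteq> N"
      by auto
    with N(2) have "negligible {x \<in> K. u x \<le> t}"
      using negligible_subset negligible_iff_null_sets by blast
    with low show False ..
  qed
  then have "average K u \<le> c * t"
    using c by (meson mult_left_mono order_trans)
  then show ?thesis
    using average_le_iff[OF K] by simp
qed

text \<open>A component \<open>J\<close> of \<open>T\<close> may consist of points with \<open>u > t\<close> only, and then the $A_1$ inequality on \<open>J\<close> itself
gives nothing. The saturation hypothesis \<open>sat\<close> says that \<open>T\<close> contains every open set on which \<open>u > t\<close> almost
everywhere. Hence, by maximality of a component, every enlargement of \<open>J\<close> inside \<open>(a, b)\<close> by \<open>\<epsilon>\<close> at both ends meets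
\<open>{u \<le> t}\<close> in a non-null set, and the enlargement costs only \<open>2 * \<epsilon>\<close> in length.\<close>

lemma component_integral_le:
  assumes u: "weight_on UNIV u" and c: "0 \<le> c"
    and A1: "\<And>I. I \<in> bounded_intervals UNIV \<Longrightarrow> AE x\<in>I in lebesgue. average I u \<le> c * u x"
    and ab: "a < b" and t: "0 \<le> t" and low: "\<not> negligible {x \<in> {a<..<b}. u x \<le> t}"
    and T: "open T" "T \<subseteq> {a<..<b}"
    and sat: "\<And>U. open U \<Longrightarrow> U \<subseteq> {a<..<b} \<Longrightarrow> negligible {x \<in> U. u x \<le> t} \<Longrightarrow> U \<subseteq> T"
    and J: "J \<in> components T"
  shows "set_lebesgue_integral lebesgue J u \<le> c * t * measure lebesgue J"
proof -
  have "open J" "connected J" "J \<noteq> {}" "J \<subseteq> T"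
    using open_components[OF T(1) J] in_components_connected[OF J] in_components_nonempty[OF J]
      in_components_subset[OF J] .
  have "bounded J"
    using \<open>J \<subseteq> T\<close> T(2) by (intro bounded_subset[of "{a..b}" J]) auto
  have "J \<in> lmeasurable"
    using \<open>open J\<close> \<open>bounded J\<close> by (intro bounded_set_imp_lmeasurable) auto
  moreover have "\<not> negligible J"
    using \<open>open J\<close> \<open>J \<noteq> {}\<close> by (rule open_not_negligible)
  ultimately have "0 < measure lebesgue J"
    by (simp add: negligible_iff_measure zero_less_measure_iff)
  then have J_int: "J \<in> bounded_intervals UNIV"
    using \<open>connected J\<close> \<open>bounded J\<close> by (simp add: bounded_intervals_def is_interval_connected_1)
  obtain \<alpha> \<beta> where \<alpha>\<beta>: "\<alpha> < \<beta>" "{\<alpha><..<\<beta>} \<subseteq> J" "J \<subseteq> {\<alpha>..\<beta>}"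
    by (rule bounded_interval_sandwich[OF J_int])
  have J_eq: "J = {\<alpha><..<\<beta>}"
    using \<alpha>\<beta>(2) interior_maximal[OF \<alpha>\<beta>(3) \<open>open J\<close>] by simp
  have "{\<alpha><..<\<beta>} \<subseteq> {a<..<b}"
    using J_eq \<open>J \<subseteq> T\<close> T(2) by simp
  then have in_ab: "a \<le> \<alpha>" "\<beta> \<le> b"
    using \<alpha>\<beta>(1) by (auto simp: greaterThanLessThan_subseteq_greaterThanLessThan)
  have step: "set_lebesgue_integral lebesgue J u \<le> c * t * (measure lebesgue J + 2 * \<epsilon>)" if \<epsilon>: "0 < \<epsilon>" for \<epsilon>
  proof -
    define K where "K = {max a (\<alpha> - \<epsilon>)<..<min b (\<beta> + \<epsilon>)}"
    have JK: "J \<subseteq> K" and K_ab: "K \<subseteq> {a<..<b}"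
      using in_ab \<epsilon> by (auto simp: J_eq K_def)
    have lt: "max a (\<alpha> - \<epsilon>) < min b (\<beta> + \<epsilon>)"
      using \<alpha>\<beta>(1) in_ab \<epsilon> ab by auto
    have K: "K \<in> bounded_intervals UNIV"
      unfolding K_def using lt by (intro open_interval_in_bounded_intervals) auto
    \<comment> \<open>Otherwise \<open>K\<close> would be part of the component \<open>J\<close>, which is possible only for \<open>J = K = (a, b)\<close>.\<close>
    have "\<not> negligible {x \<in> K. u x \<le> t}"
    proof
      assume *: "negligible {x \<in> K. u x \<le> t}"
      have "K \<subseteq> T"
        using * K_ab by (intro sat) (simp_all add: K_def)
      then have "K \<subseteq> J"
        using JK \<open>J \<noteq> {}\<close> by (intro components_maximal[OF J]) (auto simp: K_def)
      then have "max a (\<alpha> - \<epsilon>) \<ge> \<alpha>" "min b (\<beta> + \<epsilon>) \<le> \<beta>"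
        using lt by (auto simp: J_eq K_def greaterThanLessThan_subseteq_greaterThanLessThan)
      then have "K = {a<..<b}"
        using \<epsilon> in_ab by (auto simp: K_def)
      with * low show False
        by simp
    qed
    then have "set_lebesgue_integral lebesgue K u \<le> c * t * measure lebesgue K"
      by (rule set_integral_le_of_low_points[OF u A1[OF K] c K])
    moreover have "set_lebesgue_integral lebesgue J u \<le> set_lebesgue_integral lebesgue K u"
      unfolding set_lebesgue_integral_def
      using u JK J_int K weight_on_pos[OF u K]
      by (intro integral_mono)
        (auto simp: weight_on_def set_integrable_def intro: less_imp_le split: split_indicator)
    moreover have "c * t * measure lebesgue K \<le> c * t * (measure lebesgue J + 2 * \<epsilon>)"
    proof -
      have "min b (\<beta> + \<epsilon>) - max a (\<alpha> - \<epsilon>) \<le> \<beta> - \<alpha> + 2 * \<epsilon>"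
        by linarith
      then show ?thesis
        using lt \<alpha>\<beta>(1) c t by (intro mult_left_mono) (simp_all add: K_def J_eq)
    qed
    ultimately show ?thesis
      by linarith
  qed
  show ?thesis
  proof (rule le_mult_if_le_mult_add[rotated])
    show "set_lebesgue_integral lebesgue J u \<le> c * t * (measure lebesgue J + \<epsilon>)" if "0 < \<epsilon>" for \<epsilon>
      using step[of "\<epsilon> / 2"] that by simp
  qed (use c t in simp)
qed

lemma set_nn_integral_eq_set_integral:
  fixes u :: "'a \<Rightarrow> real"
  assumes "set_integrable M A u" "\<And>x. x \<in> A \<Longrightarrow> 0 \<le> u x"
  shows "(\<integral>\<^sup>+x\<in>A. ennreal (u x) \<partial>M) = ennreal (set_lebesgue_integral M A u)"
proof -
  have "(\<integral>\<^sup>+x\<in>A. ennreal (u x) \<partial>M) = (\<integral>\<^sup>+x. ennreal (indicator A x *\<^sub>R u x) \<partial>M)"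
    by (intro nn_integral_cong) (simp split: split_indicator)
  also have "\<dots> = ennreal (set_lebesgue_integral M A u)"
    unfolding set_lebesgue_integral_def using assms
    by (intro nn_integral_eq_integral) (auto simp: set_integrable_def split: split_indicator)
  finally show ?thesis .
qed

text \<open>The level set estimate with the same constant \<open>c\<close> as in the $A_1$ condition; a larger constant here would shrink
the range of exponents. The set \<open>E = {u > t}\<close> is covered by an open set \<open>T\<close> of nearly the same measure, and the estimate
is summed over the components of \<open>T\<close>. To make \<open>T\<close> saturated, it is chosen to contain the union \<open>L\<close> of all open sets on
which \<open>u > t\<close> almost everywhere; by the Lindeloef property this adds only a null set to \<open>E\<close>.\<close>

lemma level_set_integral_le:
  assumes u: "weight_on UNIV u" and c: "0 \<le> c"
    and A1: "\<And>I. I \<in> bounded_intervals UNIV \<Longrightarrow> AE x\<in>I in lebesgue. average I u \<le> c * u x"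
    and ab: "a < b" and t: "0 \<le> t" and low: "\<not> negligible {x \<in> {a<..<b}. u x \<le> t}"
  shows "set_lebesgue_integral lebesgue {x \<in> {a<..<b}. t < u x} u
    \<le> c * t * measure lebesgue {x \<in> {a<..<b}. t < u x}" (is "?l \<le> c * t * measure lebesgue ?E")
proof -
  have [measurable]: "u \<in> borel_measurable lebesgue"
    using u by (simp add: weight_on_def set_borel_measurable_def)
  have pos: "0 < u x" for x
    using u by (simp add: weight_on_def)
  have ab_int: "{a<..<b} \<in> bounded_intervals UNIV"
    using ab by (intro open_interval_in_bounded_intervals) auto
  have int: "set_integrable lebesgue {a<..<b} u"
    using u ab_int by (simp add: weight_on_def)
  have [measurable]: "{a<..<b} \<in> sets lebesgue"
    by simp
  have E[measurable]: "?E \<in> sets lebesgue"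
    by measurable
  define \<U> where "\<U> = {U. open U \<and> U \<subseteq> {a<..<b} \<and> negligible {x \<in> U. u x \<le> t}}"
  define L where "L = \<Union>\<U>"
  obtain \<V> where \<V>: "\<V> \<subseteq> \<U>" "countable \<V>" "\<Union>\<V> = L"
    unfolding L_def by (rule Lindelof[of \<U>]) (auto simp: \<U>_def)
  have "open L" "L \<subseteq> {a<..<b}"
    by (auto simp: L_def \<U>_def)
  have "negligible (\<Union>((\<lambda>U. {x \<in> U. u x \<le> t}) ` \<V>))"
    using \<V>(1,2) by (intro negligible_countable_Union) (auto simp: \<U>_def)
  moreover have "\<Union>((\<lambda>U. {x \<in> U. u x \<le> t}) ` \<V>) = L - ?E"
  proof -
    have "L - ?E = {x \<in> L. u x \<le> t}"
      using \<open>L \<subseteq> {a<..<b}\<close> by (auto simp: not_less)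
    then show ?thesis
      unfolding \<V>(3)[symmetric] by blast
  qed
  ultimately have negl: "negligible (L - ?E)"
    by simp
  have L[measurable]: "L \<in> sets lebesgue"
    using \<open>open L\<close> by simp
  have step: "?l \<le> c * t * (measure lebesgue ?E + \<epsilon>)" if \<epsilon>: "0 < \<epsilon>" for \<epsilon>
  proof -
    obtain T' where T': "open T'" "?E \<union> L \<subseteq> T'" "T' - (?E \<union> L) \<in> lmeasurable"
      "emeasure lebesgue (T' - (?E \<union> L)) < ennreal \<epsilon>"
      by (rule sets_lebesgue_outer_open[OF sets.Un[OF E L] \<epsilon>])
    define T where "T = T' \<inter> {a<..<b}"
    have T: "open T" "T \<subseteq> {a<..<b}" "?E \<union> L \<subseteq> T"
      using T'(1,2) \<open>L \<subseteq> {a<..<b}\<close> by (auto simp: T_def)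
    have T_sets[measurable]: "T \<in> sets lebesgue"
      using T(1) by simp
    have J_sets: "J \<in> sets lebesgue" if "J \<in> components T" for J
      using open_components[OF T(1) that] by simp
    have count: "countable (components T)"
      using open_components[OF T(1)] pairwise_disjoint_components[of T]
      by (intro countable_disjoint_open_subsets) (auto simp: pairwise_def disjnt_def)
    have disj: "disjoint_family_on (\<lambda>J. J) (components T)"
      using pairwise_disjoint_components[of T] by (auto simp: pairwise_def disjoint_family_on_def)
    have J_bound: "(\<integral>\<^sup>+x\<in>J. ennreal (u x) \<partial>lebesgue) \<le> ennreal (c * t) * emeasure lebesgue J"
      if J: "J \<in> components T" for J
    proof -
      have sub: "J \<subseteq> {a<..<b}"
        using in_components_subset[OF J] T(2) by blast
      have "set_integrable lebesgue J u"
        using set_integrable_subset[OF int J_sets[OF J] sub] .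
      then have "(\<integral>\<^sup>+x\<in>J. ennreal (u x) \<partial>lebesgue) = ennreal (set_lebesgue_integral lebesgue J u)"
        using pos by (intro set_nn_integral_eq_set_integral) (auto intro: less_imp_le)
      also have "\<dots> \<le> ennreal (c * t * measure lebesgue J)"
      proof (rule ennreal_leI, rule component_integral_le[OF u c A1 ab t low T(1,2) _ J])
        show "U \<subseteq> T" if "open U" "U \<subseteq> {a<..<b}" "negligible {x \<in> U. u x \<le> t}" for U
          using that T(3) by (auto simp: L_def \<U>_def)
      qed
      also have "\<dots> = ennreal (c * t) * emeasure lebesgue J"
      proof -
        have "J \<in> lmeasurable"
          using J_sets[OF J] sub by (intro bounded_set_imp_lmeasurable bounded_subset[of "{a..b}" J]) auto
        then show ?thesis
          using c t by (simp add: ennreal_mult emeasure_eq_measure2)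
      qed
      finally show ?thesis .
    qed
    let ?\<nu> = "density lebesgue (\<lambda>x. ennreal (u x))"
    have \<nu>: "emeasure ?\<nu> A = (\<integral>\<^sup>+x\<in>A. ennreal (u x) \<partial>lebesgue)" if "A \<in> sets lebesgue" for A
      using that by (intro emeasure_density) measurable
    have union: "T = \<Union>((\<lambda>J. J) ` components T)"
      by (simp add: Union_components)
    have "(\<integral>\<^sup>+x\<in>T. ennreal (u x) \<partial>lebesgue) = emeasure ?\<nu> T"
      using \<nu> by simp
    also have "\<dots> = (\<integral>\<^sup>+J. emeasure ?\<nu> J \<partial>count_space (components T))"
      by (subst union, rule emeasure_UN_countable) (use count disj J_sets in auto)
    also have "\<dots> \<le> (\<integral>\<^sup>+J. ennreal (c * t) * emeasure lebesgue J \<partial>count_space (components T))"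
      using J_bound J_sets by (intro nn_integral_mono) (simp add: \<nu>)
    also have "\<dots> = ennreal (c * t) * (\<integral>\<^sup>+J. emeasure lebesgue J \<partial>count_space (components T))"
      by (rule nn_integral_cmult) simp
    also have "(\<integral>\<^sup>+J. emeasure lebesgue J \<partial>count_space (components T)) = emeasure lebesgue T"
      by (subst (2) union, rule emeasure_UN_countable[symmetric]) (use count disj J_sets in auto)
    finally have T_bound: "(\<integral>\<^sup>+x\<in>T. ennreal (u x) \<partial>lebesgue) \<le> ennreal (c * t) * emeasure lebesgue T" .
    have T'_sets: "T' \<in> sets lebesgue"
      using T'(1) by simp
    note parts = sets.Diff[OF L E] sets.Diff[OF T'_sets sets.Un[OF E L]]
    have "emeasure lebesgue T \<le> emeasure lebesgue (?E \<union> ((L - ?E) \<union> (T' - (?E \<union> L))))"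
      by (rule emeasure_mono, use T_def in blast, intro sets.Un E parts)
    also have "\<dots> \<le> emeasure lebesgue ?E + (emeasure lebesgue (L - ?E) + emeasure lebesgue (T' - (?E \<union> L)))"
      by (intro order_trans[OF emeasure_subadditive] add_left_mono emeasure_subadditive sets.Un E parts)
    also have "emeasure lebesgue (L - ?E) = 0"
      using negl unfolding negligible_iff_null_sets by (rule null_setsD1)
    also have "emeasure lebesgue ?E + (0 + emeasure lebesgue (T' - (?E \<union> L))) \<le> ennreal (measure lebesgue ?E) + ennreal \<epsilon>"
    proof -
      have "bounded ?E"
        by (rule bounded_subset[of "{a..b}"]) auto
      then have "?E \<in> lmeasurable"
        using E by (rule bounded_set_imp_lmeasurable)
      then have "emeasure lebesgue ?E = ennreal (measure lebesgue ?E)"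
        by (rule emeasure_eq_measure2)
      then show ?thesis
        unfolding add_0 using less_imp_le[OF T'(4)] by (intro add_mono) (simp_all only: order_refl)
    qed
    finally have T_meas: "emeasure lebesgue T \<le> ennreal (measure lebesgue ?E + \<epsilon>)"
      using \<epsilon> by simp
    have ct_nn: "0 \<le> c * t" and m_nn: "0 \<le> measure lebesgue ?E + \<epsilon>"
      using c t \<epsilon> measure_nonneg[of lebesgue ?E] by (intro mult_nonneg_nonneg add_nonneg_nonneg; linarith)+
    have "ennreal ?l = (\<integral>\<^sup>+x\<in>?E. ennreal (u x) \<partial>lebesgue)"
      using pos by (intro set_nn_integral_eq_set_integral[symmetric] set_integrable_subset[OF int E]) (auto intro: less_imp_le)
    also have "\<dots> \<le> (\<integral>\<^sup>+x\<in>T. ennreal (u x) \<partial>lebesgue)"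
      using T(3) by (intro nn_set_integral_set_mono) auto
    also have "\<dots> \<le> ennreal (c * t) * emeasure lebesgue T"
      by (rule T_bound)
    also have "\<dots> \<le> ennreal (c * t) * ennreal (measure lebesgue ?E + \<epsilon>)"
      using T_meas by (rule mult_left_mono) simp
    also have "\<dots> = ennreal (c * t * (measure lebesgue ?E + \<epsilon>))"
      by (rule ennreal_mult[OF ct_nn m_nn, symmetric])
    finally show ?thesis
      unfolding ennreal_le_iff[OF mult_nonneg_nonneg[OF ct_nn m_nn]] .
  qed
  show ?thesis
    by (rule le_mult_if_le_mult_add[OF _ step]) (use c t in simp)
qed

section \<open>Sharp self-improvement of $A_1$ and $A_p$ weights\<close>

text \<open>The sharp reverse Hoelder inequality. Above the average \<open>m\<close> of \<open>u\<close> over an interval, the level sets of \<open>u\<close> cannot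
fill the interval up to a null set, so the level set estimate is available for every level \<open>t > m\<close>. It bounds
the average of $u^\tau$ by a multiple of $m^\tau$, and the $A_1$ inequality for \<open>u\<close> bounds \<open>m\<close> pointwise.\<close>

lemma A_1_powr:
  assumes u: "weight_on UNIV u" and c: "1 \<le> c"
    and A1: "\<And>I. I \<in> bounded_intervals UNIV \<Longrightarrow> AE x\<in>I in lebesgue. average I u \<le> c * u x"
    and \<tau>: "1 < \<tau>" "c * (\<tau> - 1) < \<tau>"
  shows "A_1 UNIV (\<lambda>x. u x powr \<tau>)"
proof -
  define K where "K = \<tau> / (\<tau> - c * (\<tau> - 1))"
  have K: "0 < K"
    using \<tau> by (simp add: K_def)
  have pos: "0 < u x" for x
    using u by (simp add: weight_on_def)
  have [measurable]: "u \<in> borel_measurable lebesgue"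
    using u by (simp add: weight_on_def set_borel_measurable_def)
  have rev_Hoelder: "set_integrable lebesgue I (\<lambda>x. u x powr \<tau>) \<and> average I (\<lambda>x. u x powr \<tau>) \<le> K * average I u powr \<tau>"
    if I: "I \<in> bounded_intervals UNIV" for I
  proof -
    obtain a b where ab: "a < b"
      and int_I: "\<forall>f\<in>(borel_measurable lebesgue :: (real \<Rightarrow> real) set). set_integrable lebesgue I f \<longleftrightarrow> set_integrable lebesgue {a<..<b} f"
      and avg_I: "\<forall>f\<in>borel_measurable lebesgue. average I f = average {a<..<b} f"
      by (rule bounded_interval_as_open[OF I])
    let ?J = "{a<..<b}"
    let ?M = "restrict_space lebesgue ?J"
    have J: "?J \<in> bounded_intervals UNIV"
      using ab by (intro open_interval_in_bounded_intervals) auto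
    have J_sets: "?J \<inter> space lebesgue \<in> sets lebesgue"
      by simp
    interpret M: finite_measure ?M
      using ab by (intro finite_measureI) (simp add: space_restrict_space emeasure_restrict_space)
    define m where "m = average ?J u"
    have m: "0 < m"
      unfolding m_def by (rule average_pos[OF u J])
    have u_int: "set_integrable lebesgue ?J u"
      using u J by (simp add: weight_on_def)
    have u_int': "integrable ?M u"
      using u_int by (simp add: integrable_restrict_space set_integrable_def)
    have u_total: "(\<integral>x. u x \<partial>?M) = m * (b - a)"
      using ab by (simp add: m_def average_def integral_restrict_space set_lebesgue_integral_def)
    have level: "(\<integral>x. u x * indicator {x \<in> space ?M. t < u x} x \<partial>?M) \<le> c * t * measure ?M {x \<in> space ?M. t < u x}"
      if t: "m < t" for t
    proof -
      have "\<not> negligible {x \<in> ?J. u x \<le> t}"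
      proof
        assume "negligible {x \<in> ?J. u x \<le> t}"
        then have "AE x in lebesgue. x \<notin> {x \<in> ?J. u x \<le> t}"
          by (intro AE_not_in) (simp add: negligible_iff_null_sets)
        then have "AE x\<in>?J in lebesgue. t \<le> u x"
          by (rule eventually_mono) auto
        then have "average ?J (\<lambda>_. t) \<le> average ?J u"
          by (intro average_mono_AE[OF J] set_integrable_const_interval[OF J] u_int)
        with t show False
          by (simp add: average_const[OF J] m_def)
      qed
      then have "set_lebesgue_integral lebesgue {x \<in> ?J. t < u x} u \<le> c * t * measure lebesgue {x \<in> ?J. t < u x}"
        using c m t by (intro level_set_integral_le[OF u _ A1 ab]) auto
      moreover have "(\<integral>x. u x * indicator {x \<in> space ?M. t < u x} x \<partial>?M)
          = set_lebesgue_integral lebesgue {x \<in> ?J. t < u x} u"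
        unfolding integral_restrict_space[OF J_sets] set_lebesgue_integral_def
        by (intro Bochner_Integration.integral_cong) (auto simp: space_restrict_space indicator_def)
      moreover have "measure ?M {x \<in> space ?M. t < u x} = measure lebesgue {x \<in> ?J. t < u x}"
        by (subst measure_restrict_space) (auto simp: space_restrict_space)
      ultimately show ?thesis
        by simp
    qed
    have "0 \<le> c"
      using c by simp
    note bd = M.power_integral_le_of_level_sets[OF u_int' less_imp_le[OF pos] m this \<tau> level]
    have int_J: "set_integrable lebesgue ?J (\<lambda>x. u x powr \<tau>)"
      using bd(1) by (simp add: integrable_restrict_space set_integrable_def)
    have "average ?J (\<lambda>x. u x powr \<tau>) \<le> K * m powr (\<tau> - 1) * m"
      using bd(2) ab unfolding u_total K_def[symmetric]
      by (simp add: average_def integral_restrict_space set_lebesgue_integral_def field_simps)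
    also have "\<dots> = K * m powr \<tau>"
      using m powr_add[of m "\<tau> - 1" 1] by simp
    finally have avg_J: "average ?J (\<lambda>x. u x powr \<tau>) \<le> K * m powr \<tau>" .
    with int_J show ?thesis
      by (simp add: int_I avg_I m_def)
  qed
  have w: "weight_on UNIV (\<lambda>x. u x powr \<tau>)"
    unfolding weight_on_def
  proof (intro conjI ballI)
    show "0 < u x powr \<tau>" for x
      using pos[of x] by simp
    show "set_borel_measurable lebesgue UNIV (\<lambda>x. u x powr \<tau>)"
      by (simp add: set_borel_measurable_def)
  qed (use rev_Hoelder in blast)
  have "K * c powr \<tau> \<in> A1_bounds UNIV (\<lambda>x. u x powr \<tau>)"
  proof (subst A1_bounds_iff[OF w], use K c in simp, rule ballI)
    fix I assume I: "I \<in> bounded_intervals UNIV"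
    show "AE x\<in>I in lebesgue. average I (\<lambda>x. u x powr \<tau>) \<le> K * c powr \<tau> * u x powr \<tau>"
      using A1[OF I]
    proof (rule eventually_mono, intro impI)
      fix x assume "x \<in> I \<longrightarrow> average I u \<le> c * u x" "x \<in> I"
      then have "average I u powr \<tau> \<le> (c * u x) powr \<tau>"
        using average_pos[OF u I] \<tau> by (intro powr_mono2) auto
      also have "\<dots> = c powr \<tau> * u x powr \<tau>"
        using c pos[of x] by (simp add: powr_mult)
      finally have "K * average I u powr \<tau> \<le> K * (c powr \<tau> * u x powr \<tau>)"
        using K by simp
      then show "average I (\<lambda>x. u x powr \<tau>) \<le> K * c powr \<tau> * u x powr \<tau>"
        using rev_Hoelder[OF I] by (simp add: mult.assoc)
    qed
  qed
  with w show ?thesis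
    by (auto simp: A_1_def)
qed

lemma average_le_of_A1_const_less:
  assumes u: "A_1 X u" and d: "A1_const X u < d"
    and I: "I \<in> bounded_intervals X"
  shows "AE x\<in>I in lebesgue. average I u \<le> d * u x"
proof -
  have w: "weight_on X u"
    using u by (simp add: A_1_def)
  obtain c where c: "c \<in> A1_bounds X u" "c < d"
    using u d unfolding A_1_def A1_const_def by (meson cInf_lessD)
  have "1 \<le> c"
    using A1_bounds_ge_1[OF w c(1) I] .
  then have "AE x\<in>I in lebesgue. average I u \<le> c * u x"
    using A1_bounds_iff[OF w, of c] c(1) I by simp
  then show ?thesis
  proof (rule eventually_mono, intro impI)
    fix x assume "x \<in> I \<longrightarrow> average I u \<le> c * u x" "x \<in> I"
    then show "average I u \<le> d * u x"
      using weight_on_pos[OF w I, of x] c(2) by (meson less_imp_le mult_right_mono order_trans)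
  qed
qed

text \<open>Since the range of exponents is open, \<open>c\<close> may be replaced by a slightly larger \<open>d\<close>. This is a true $A_1$ bound for both
weights, whether or not the infimum is attained, and it also covers \<open>c = 1\<close>.\<close>

lemma A_p_powr:
  assumes p: "1 < p" and u: "A_1 UNIV u" and v: "A_1 UNIV v"
    and c: "c = max (A1_const UNIV u) (A1_const UNIV v)"
    and \<tau>: "1 \<le> \<tau>" "c = 1 \<or> \<tau> < c / (c - 1)"
  shows "A_p UNIV p (\<lambda>x. (u x * v x powr (1 - p)) powr \<tau>)"
proof -
  have wu: "weight_on UNIV u" and wv: "weight_on UNIV v"
    using u v by (simp_all add: A_1_def)
  have pos: "0 < u x" "0 < v x" for x
    using wu wv by (simp_all add: weight_on_def)
  have I: "{0<..<1} \<in> bounded_intervals UNIV"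
    by (intro open_interval_in_bounded_intervals) auto
  have "1 \<le> c"
    using u A1_bounds_ge_1[OF wu _ I] unfolding c A1_const_def A_1_def
    by (intro max.coboundedI1 cInf_greatest) auto
  show ?thesis
  proof (cases "\<tau> = 1")
    case True
    have "(u x * v x powr (1 - p)) powr \<tau> = u x * v x powr (1 - p)" for x
      using pos[of x] True by simp
    then show ?thesis
      using A_p_of_A_1[OF p u v] by simp
  next
    case False
    with \<tau> have \<tau>1: "1 < \<tau>"
      by simp
    have "c * (\<tau> - 1) < \<tau>"
      using \<tau>(2)
    proof
      assume "\<tau> < c / (c - 1)"
      with \<open>1 \<le> c\<close> \<tau>1 show ?thesis
        by (cases "c = 1") (auto simp: field_simps)
    qed simp
    then have "c < \<tau> / (\<tau> - 1)"
      using \<tau>1 by (simp add: field_simps)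
    then obtain d where d: "c < d" "d < \<tau> / (\<tau> - 1)"
      using dense by blast
    have d\<tau>: "d * (\<tau> - 1) < \<tau>" and d1: "1 \<le> d"
      using d \<tau>1 \<open>1 \<le> c\<close> by (simp_all add: field_simps)
    \<comment> \<open>Raising to the power \<open>\<tau>\<close> respects the factorization of \<open>w\<close>, so it suffices to treat \<open>u\<close> and \<open>v\<close> separately.\<close>
    have "A_1 UNIV (\<lambda>x. u x powr \<tau>)"
      by (rule A_1_powr[OF wu d1 _ \<tau>1 d\<tau>], rule average_le_of_A1_const_less[OF u])
        (use d(1) in \<open>simp_all add: c\<close>)
    moreover have "A_1 UNIV (\<lambda>x. v x powr \<tau>)"
      by (rule A_1_powr[OF wv d1 _ \<tau>1 d\<tau>], rule average_le_of_A1_const_less[OF v])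
        (use d(1) in \<open>simp_all add: c\<close>)
    ultimately have "A_p UNIV p (\<lambda>x. u x powr \<tau> * (v x powr \<tau>) powr (1 - p))"
      using p by (intro A_p_of_A_1) auto
    moreover have "u x powr \<tau> * (v x powr \<tau>) powr (1 - p) = (u x * v x powr (1 - p)) powr \<tau>" for x
      using pos[of x] by (simp add: powr_mult powr_powr mult.commute)
    ultimately show ?thesis
      by simp
  qed
qed

section \<open>Power weights on the half-line\<close>

lemma powr_integral_Ioo:
  assumes ab: "0 \<le> a" "a < b" and \<alpha>: "\<alpha> < (1::real)"
  shows "set_integrable lebesgue {a<..<b} (\<lambda>x. x powr -\<alpha>)"
    and "set_lebesgue_integral lebesgue {a<..<b} (\<lambda>x. x powr -\<alpha>)
      = (b powr (1 - \<alpha>) - a powr (1 - \<alpha>)) / (1 - \<alpha>)"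
proof -
  have "((\<lambda>x. x powr -\<alpha>) has_integral (b powr (1 - \<alpha>) / (1 - \<alpha>) - a powr (1 - \<alpha>) / (1 - \<alpha>))) {a..b}"
  proof (rule fundamental_theorem_of_calculus_interior)
    show "continuous_on {a..b} (\<lambda>x. x powr (1 - \<alpha>) / (1 - \<alpha>))"
      using ab \<alpha> by (intro continuous_intros continuous_on_powr') auto
    show "((\<lambda>x. x powr (1 - \<alpha>) / (1 - \<alpha>)) has_vector_derivative x powr -\<alpha>) (at x)" if "x \<in> {a<..<b}" for x
      using that ab \<alpha>
      by (auto intro!: derivative_eq_intros simp: has_real_derivative_iff_has_vector_derivative[symmetric])
  qed (use ab in simp)
  then have I: "((\<lambda>x. x powr -\<alpha>) has_integral (b powr (1 - \<alpha>) - a powr (1 - \<alpha>)) / (1 - \<alpha>)) {a<..<b}"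
    by (simp add: has_integral_Icc_iff_Ioo diff_divide_distrib)
  then show int: "set_integrable lebesgue {a<..<b} (\<lambda>x. x powr -\<alpha>)"
    by (intro nonnegative_absolutely_integrable_1) auto
  show "set_lebesgue_integral lebesgue {a<..<b} (\<lambda>x. x powr -\<alpha>)
      = (b powr (1 - \<alpha>) - a powr (1 - \<alpha>)) / (1 - \<alpha>)"
    using set_lebesgue_integral_eq_integral(2)[OF int] integral_unique[OF I] by simp
qed

lemma open_interval_subset_positive:
  fixes a b :: real
  assumes "a < b" "{a<..<b} \<subseteq> {0<..}"
  shows "0 \<le> a"
proof (rule ccontr)
  assume "\<not> 0 \<le> a"
  with assms(1) have "(a + min b 0) / 2 \<in> {a<..<b}" "(a + min b 0) / 2 \<le> 0"
    by (auto simp: min_def)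
  with assms(2) show False
    by (meson greaterThan_iff linorder_not_le subsetD)
qed

lemma measurable_powr_lebesgue: "(\<lambda>x::real. x powr r) \<in> borel_measurable lebesgue"
  by (intro measurable_completion) simp

lemma powr_weight_on_half_line:
  assumes \<alpha>: "\<alpha> < (1::real)"
  shows "weight_on {0<..} (\<lambda>x. x powr -\<alpha>)"
  unfolding weight_on_def
proof (intro conjI ballI)
  show "set_borel_measurable lebesgue {0<..} (\<lambda>x::real. x powr -\<alpha>)"
    unfolding set_borel_measurable_def by (intro measurable_completion) simp
  fix I assume "I \<in> bounded_intervals {0<..}"
  then obtain a b where ab: "a < b" "{a<..<b} \<subseteq> {0<..}"
    and eq: "\<forall>f\<in>(borel_measurable lebesgue :: (real \<Rightarrow> real) set). set_integrable lebesgue I f \<longleftrightarrow> set_integrable lebesgue {a<..<b} f"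
    by (rule bounded_interval_as_open)
  show "set_integrable lebesgue I (\<lambda>x. x powr -\<alpha>)"
    unfolding bspec[OF eq measurable_powr_lebesgue]
    by (rule powr_integral_Ioo(1)[OF open_interval_subset_positive[OF ab] ab(1) \<alpha>])
qed simp

text \<open>Among intervals with right endpoint \<open>b\<close>, the average of the decreasing function $x^{-\alpha}$ is largest over \<open>(0, b)\<close>,
where it equals $b^{-\alpha}/(1-\alpha)$. The interval \<open>(0, 1)\<close> shows that no smaller constant works.\<close>

lemma powr_A1_const:
  assumes \<alpha>: "0 \<le> \<alpha>" "\<alpha> < (1::real)"
  shows "A_1 {0<..} (\<lambda>x. x powr -\<alpha>)" "A1_const {0<..} (\<lambda>x. x powr -\<alpha>) = 1 / (1 - \<alpha>)"
proof -
  let ?w = "\<lambda>x. x powr -\<alpha>" and ?k = "1 / (1 - \<alpha>)"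
  note w = powr_weight_on_half_line[OF \<alpha>(2)]
  have k: "0 < ?k"
    using \<alpha> by simp
  have mem: "?k \<in> A1_bounds {0<..} ?w"
    unfolding A1_bounds_iff[OF w k]
  proof (intro ballI AE_I2 impI)
    fix I x assume I: "I \<in> bounded_intervals {0<..}" and x: "x \<in> I"
    obtain a b where ab: "a < b" "{a<..<b} \<subseteq> {0<..}" and Iab: "I \<subseteq> {a..b}"
      and eq: "\<forall>f\<in>borel_measurable lebesgue. average I f = average {a<..<b} f"
      using I by (rule bounded_interval_as_open)
    have a: "0 \<le> a"
      using open_interval_subset_positive[OF ab] .
    have x: "0 < x" "x \<le> b"
      using x I Iab by (auto simp: bounded_intervals_def)
    have b_eq: "b powr (1 - \<alpha>) = b * b powr -\<alpha>"
      using a ab powr_add[of b 1 "-\<alpha>"] by simp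
    have a_ge: "a * b powr -\<alpha> \<le> a powr (1 - \<alpha>)"
    proof (cases "a = 0")
      case False
      with a ab \<alpha> have "b powr -\<alpha> \<le> a powr -\<alpha>"
        by (intro powr_mono2') auto
      then have "a * b powr -\<alpha> \<le> a * a powr -\<alpha>"
        using a by (rule mult_left_mono)
      also have "\<dots> = a powr (1 - \<alpha>)"
        using a False powr_add[of a 1 "-\<alpha>"] by simp
      finally show ?thesis .
    qed simp
    have "average I ?w = average {a<..<b} ?w"
      by (rule bspec[OF eq measurable_powr_lebesgue])
    also have "\<dots> = (b powr (1 - \<alpha>) - a powr (1 - \<alpha>)) / (b - a) * ?k"
      using ab by (simp add: average_def powr_integral_Ioo(2)[OF a ab(1) \<alpha>(2)])
    also have "\<dots> \<le> b powr -\<alpha> * ?k"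
    proof (rule mult_right_mono)
      have "b powr (1 - \<alpha>) - a powr (1 - \<alpha>) \<le> b powr -\<alpha> * (b - a)"
        using a_ge b_eq by (simp add: algebra_simps)
      then show "(b powr (1 - \<alpha>) - a powr (1 - \<alpha>)) / (b - a) \<le> b powr -\<alpha>"
        using ab by (simp add: pos_divide_le_eq)
    qed (use k in simp)
    also have "\<dots> \<le> x powr -\<alpha> * ?k"
      using x \<alpha> k by (intro mult_right_mono powr_mono2') auto
    finally show "average I ?w \<le> ?k * ?w x"
      by (simp add: mult.commute)
  qed
  then show "A_1 {0<..} ?w"
    using w by (auto simp: A_1_def)
  have "?k \<le> c" if c: "c \<in> A1_bounds {0<..} ?w" for c
  proof -
    have J: "{0<..<1} \<in> bounded_intervals {0<..}"
      by (intro open_interval_in_bounded_intervals) auto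
    have "1 \<le> c"
      by (rule A1_bounds_ge_1[OF w c J])
    then have "\<forall>I\<in>bounded_intervals {0<..}. AE x\<in>I in lebesgue. average I ?w \<le> c * ?w x"
      using A1_bounds_iff[OF w, of c] c by simp
    note AE = bspec[OF this J]
    have avg: "average {0<..<1} ?w = ?k"
      using powr_integral_Ioo(2)[of 0 1 \<alpha>] \<alpha> by (simp add: average_def)
    have le: "?k \<le> c * y powr -\<alpha>" if y: "0 < y" "y < 1" for y
    proof -
      have "\<exists>x\<in>{y<..<1}. ?k \<le> c * ?w x"
      proof (rule ccontr)
        assume "\<not> ?thesis"
        then have "AE x in lebesgue. x \<notin> {y<..<1}"
          using AE y unfolding avg by (elim eventually_mono) auto
        then have "{y<..<1} \<in> null_sets lebesgue"
          by (simp add: AE_iff_null_sets)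
        then have "measure lebesgue {y<..<1} = 0"
          by (rule measure_eq_0_null_sets)
        then show False
          using y by simp
      qed
      then obtain x where x: "y < x" "x < 1" "?k \<le> c * ?w x"
        by auto
      moreover have "c * ?w x \<le> c * ?w y"
        using x y \<alpha> \<open>1 \<le> c\<close> by (intro mult_left_mono powr_mono2') auto
      ultimately show ?thesis
        by linarith
    qed
    have "((\<lambda>y. c * y powr -\<alpha>) \<longlongrightarrow> c * 1 powr -\<alpha>) (at_left 1)"
      by (intro tendsto_intros) auto
    moreover have "\<forall>\<^sub>F y in at_left 1. ?k \<le> c * y powr -\<alpha>"
      by (rule eventually_at_leftI[of 0]) (use le in auto)
    ultimately have "?k \<le> c * 1 powr -\<alpha>"
      by (rule tendsto_lowerbound) simp
    then show ?thesis
      by simp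
  qed
  then show "A1_const {0<..} ?w = ?k"
    unfolding A1_const_def using mem by (intro cInf_eq_minimum)
qed

lemma powr_not_integrable:
  assumes r: "r \<le> (-1::real)"
  shows "\<not> set_integrable lebesgue {0<..<1} (\<lambda>x. x powr r)"
proof
  assume int: "set_integrable lebesgue {0<..<1} (\<lambda>x. x powr r)"
  define C where "C = set_lebesgue_integral lebesgue {0<..<1} (\<lambda>x. x powr r)"
  obtain n :: nat where n: "max C 0 < real n"
    using reals_Archimedean2 by blast
  define e where "e = exp (- real n)"
  have e: "0 < e" "e < 1"
    using n by (simp_all add: e_def)
  have "((\<lambda>x. 1 / x) has_integral (ln 1 - ln e)) {e..1}"
    using e by (intro fundamental_theorem_of_calculus)
      (auto intro!: derivative_eq_intros simp: has_real_derivative_iff_has_vector_derivative[symmetric])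
  then have I: "((\<lambda>x. 1 / x) has_integral real n) {e<..<1}"
    by (simp add: e_def has_integral_Icc_iff_Ioo)
  have int1: "set_integrable lebesgue {e<..<1} (\<lambda>x. 1 / x)"
    using I e by (intro nonnegative_absolutely_integrable_1) auto
  have "real n = set_lebesgue_integral lebesgue {e<..<1} (\<lambda>x. 1 / x)"
    using set_lebesgue_integral_eq_integral(2)[OF int1] integral_unique[OF I] by simp
  also have "\<dots> \<le> C"
    unfolding C_def set_lebesgue_integral_def
  proof (rule integral_mono)
    fix x :: real
    show "indicat_real {e<..<1} x *\<^sub>R (1 / x) \<le> indicat_real {0<..<1} x *\<^sub>R (x powr r)"
    proof (cases "x \<in> {e<..<1}")
      case True
      then have x: "0 < x" "x \<le> 1"
        using e by auto
      then have "x powr -1 \<le> x powr r"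
        using r by (intro powr_mono') auto
      with True x show ?thesis
        by (simp add: powr_minus_divide)
    qed simp
  qed (use int int1 in \<open>simp_all add: set_integrable_def\<close>)
  finally show False
    using n by simp
qed

text \<open>The exponent $\alpha = 1 - 1/c$ is chosen so that $x^{-\alpha}$ has $A_1$ constant \<open>c\<close>, and $\alpha\tau \ge 1$ holds
exactly when $\tau \ge c/(c-1)$. The second weight is the constant 1, written as the power 0 of \<open>x\<close> so
that it belongs to the same family.\<close>

lemma power_weight_attains_exponent:
  assumes p: "1 < p" and c: "(1::real) < c"
  defines "u \<equiv> (\<lambda>x::real. x powr -(1 - 1 / c))" and "v \<equiv> (\<lambda>x::real. x powr -0)"
  shows "A_1 {0<..} u" "A_1 {0<..} v" "max (A1_const {0<..} u) (A1_const {0<..} v) = c"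
    "A_p {0<..} p (\<lambda>x. u x * v x powr (1 - p))"
    "c / (c - 1) \<le> \<tau> \<Longrightarrow> \<not> A_p {0<..} p (\<lambda>x. (u x * v x powr (1 - p)) powr \<tau>)"
proof -
  have \<alpha>: "0 \<le> 1 - 1 / c" "1 - 1 / c < 1"
    using c by simp_all
  show u: "A_1 {0<..} u" and v: "A_1 {0<..} v"
    unfolding u_def v_def using \<alpha> by (intro powr_A1_const; simp)+
  have "A1_const {0<..} u = c" "A1_const {0<..} v = 1"
    unfolding u_def v_def using powr_A1_const(2)[OF \<alpha>] powr_A1_const(2)[of 0] by simp_all
  then show "max (A1_const {0<..} u) (A1_const {0<..} v) = c"
    using c by simp
  show "A_p {0<..} p (\<lambda>x. u x * v x powr (1 - p))"
    using p u v by (intro A_p_of_A_1) simp_all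
  show "\<not> A_p {0<..} p (\<lambda>x. (u x * v x powr (1 - p)) powr \<tau>)" if \<tau>: "c / (c - 1) \<le> \<tau>"
  proof
    assume "A_p {0<..} p (\<lambda>x. (u x * v x powr (1 - p)) powr \<tau>)"
    moreover have "{0<..<1} \<in> bounded_intervals {0<..}"
      by (intro open_interval_in_bounded_intervals) auto
    ultimately have "set_integrable lebesgue {0<..<1} (\<lambda>x. (u x * v x powr (1 - p)) powr \<tau>)"
      by (simp add: A_p_def weight_on_def)
    moreover have "set_integrable lebesgue {0<..<1} (\<lambda>x. (u x * v x powr (1 - p)) powr \<tau>)
        \<longleftrightarrow> set_integrable lebesgue {0<..<1} (\<lambda>x. x powr (- (1 - 1 / c) * \<tau>))"
      by (rule set_integrable_cong) (auto simp: u_def v_def powr_powr)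
    moreover have "- (1 - 1 / c) * \<tau> \<le> -1"
      using c \<tau> by (simp add: field_simps)
    ultimately show False
      using powr_not_integrable by blast
  qed
qed

section \<open>Best possible exponents for powers of $A_p$ weights\<close>

theorem mainTheorem5:
  shows
    "(\<forall>(p::real) (u::real \<Rightarrow> real) (v::real \<Rightarrow> real) (w::real \<Rightarrow> real) (c::real).
        1 < p \<and> A_1 UNIV u \<and> A_1 UNIV v \<and>
        w = (\<lambda>x. u x * v x powr (1 - p)) \<and> A_p UNIV p w \<and>
        c = max (A1_const UNIV u) (A1_const UNIV v) \<longrightarrow>
        (\<forall>\<tau>::real. 1 \<le> \<tau> \<and> (c = 1 \<or> \<tau> < c / (c - 1)) \<longrightarrow>
           A_p UNIV p (\<lambda>x. w x powr \<tau>)))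
     \<and>
     (\<forall>(p::real) (c::real). 1 < p \<and> 1 < c \<longrightarrow>
        (\<exists>(u::real \<Rightarrow> real) (v::real \<Rightarrow> real) (w::real \<Rightarrow> real).
           A_1 {0<..} u \<and> A_1 {0<..} v \<and>
           max (A1_const {0<..} u) (A1_const {0<..} v) = c \<and>
           w = (\<lambda>x. u x * v x powr (1 - p)) \<and> A_p {0<..} p w \<and>
           (\<forall>\<tau>::real. c / (c - 1) \<le> \<tau> \<longrightarrow> \<not> A_p {0<..} p (\<lambda>x. w x powr \<tau>))))"
proof (intro conjI allI impI)
  fix p c \<tau> :: real and u v w :: "real \<Rightarrow> real"
  assume "1 < p \<and> A_1 UNIV u \<and> A_1 UNIV v \<and> w = (\<lambda>x. u x * v x powr (1 - p)) \<and> A_p UNIV p w \<and>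
    c = max (A1_const UNIV u) (A1_const UNIV v)"
    and "1 \<le> \<tau> \<and> (c = 1 \<or> \<tau> < c / (c - 1))"
  then show "A_p UNIV p (\<lambda>x. w x powr \<tau>)"
    using A_p_powr[of p u v c \<tau>] by simp
next
  fix p c :: real
  assume "1 < p \<and> 1 < c"
  then have "1 < p" "1 < c"
    by simp_all
  note ex = power_weight_attains_exponent[OF this]
  show "\<exists>u v w. A_1 {0<..} u \<and> A_1 {0<..} v \<and>
      max (A1_const {0<..} u) (A1_const {0<..} v) = c \<and>
      w = (\<lambda>x. u x * v x powr (1 - p)) \<and> A_p {0<..} p w \<and>
      (\<forall>\<tau>. c / (c - 1) \<le> \<tau> \<longrightarrow> \<not> A_p {0<..} p (\<lambda>x. w x powr \<tau>))"
    by (intro exI conjI allI impI, rule ex(1), rule ex(2), rule ex(3), rule refl, rule ex(4), rule ex(5))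
qed

end
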